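(* Let $\mathbb{F}$ be an algebraically closed field and let $q\in\mathbb{F}$ be nonzero with $q^4\neq 1$. Let $\Delta$ be the universal Askey-Wilson algebra over $\mathbb{F}$ with parameter $q$, presented as $\Delta=\mathbb{F}\langle A,B,C\rangle/\mathbb{I}$. Let $\mathcal{L}$ be the free Lie algebra on $\{A,B,C\}$, realized as the Lie subalgebra of $\mathbb{F}\langle A,B,C\rangle$ generated by $A,B,C$. Then the Lie subalgebra $L=\mathcal{L}/(\mathbb{I}\cap\mathcal{L})$ of $\Delta$ generated by $A,B,C$ is not freely generated by $A,B,C$; that is, $\mathbb{I}\cap\mathcal{L}\neq 0$.
   Context: $\mathbb{F}\langle A,B,C\rangle$ is the free unital associative $\mathbb{F}$-algebra on three letters $A,B,C$; every associative algebra is viewed as a Lie algebra with $[X,Y]=XY-YX$. In $\mathbb{F}\langle A,B,C\rangle$ put $\alpha=(q+q^{-1})A+\frac{qBC-q^{-1}CB}{q-q^{-1}}$, $\beta=(q+q^{-1})B+\frac{qCA-q^{-1}AC}{q-q^{-1}}$, $\gamma=(q+q^{-1})C+\frac{qAB-q^{-1}BA}{q-q^{-1}}$. $\mathbb{I}$ is the two-sided ideal generated by the nine elements $[X,\delta]$ with $X\in\{A,B,C\}$, $\delta\in\{\alpha,\beta,\gamma\}$, and the universal Askey-Wilson algebra is $\Delta=\mathbb{F}\langle A,B,C\rangle/\mathbb{I}$. *)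

theory Defs
  imports
    "HOL-Computational_Algebra.Polynomial"
    "HOL-Library.Poly_Mapping"
    "HOL-Algebra.QuotRing"
    "HOL-Algebra.Module"
begin

section \<open>The free unital associative algebra on three letters\<close>

datatype letter = LA | LB | LC

text \<open>Lists form the free monoid.  It is written additively because the convolution product of
  \<^theory>\<open>HOL-Library.Poly_Mapping\<close> is indexed by additive monoids; with this instance,
  \<open>letter list \<Rightarrow>\<^sub>0 'f\<close> with its library ring structure is the algebra of noncommutative polynomials
  in the three letters with coefficients in \<open>'f\<close>.\<close>

instantiation list :: (type) monoid_add
begin
definition zero_list :: "'a list" where "zero_list = []"
definition plus_list :: "'a list \<Rightarrow> 'a list \<Rightarrow> 'a list" where "plus_list xs ys = xs @ ys"
instance by standard (simp_all add: zero_list_def plus_list_def)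
end

type_synonym 'f free_alg = "letter list \<Rightarrow>\<^sub>0 'f"

definition scal :: "'f::field \<Rightarrow> 'f free_alg \<Rightarrow> 'f free_alg" where
  "scal c x = Poly_Mapping.map ((*) c) x"

definition gen :: "letter \<Rightarrow> 'f::field free_alg" where
  "gen l = Poly_Mapping.single [l] 1"

definition free_algebra :: "('f::field, 'f free_alg) module" where
  "free_algebra = \<lparr>carrier = UNIV, mult = (*), one = 1, zero = 0, add = (+), smult = scal\<rparr>"


section \<open>Associative algebras as Lie algebras\<close>

text \<open>An associative algebra over \<open>'f\<close> is given by a \<open>module\<close> record, which carries the
  multiplication and the unit as well; the scalars are all of the type \<open>'f\<close>.\<close>

definition lie_bracket :: "('f, 'a) module \<Rightarrow> 'a \<Rightarrow> 'a \<Rightarrow> 'a" where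
  "lie_bracket R x y = (x \<otimes>\<^bsub>R\<^esub> y) \<ominus>\<^bsub>R\<^esub> (y \<otimes>\<^bsub>R\<^esub> x)"

definition lie_subalgebra :: "('f, 'a) module \<Rightarrow> 'a set \<Rightarrow> bool" where
  "lie_subalgebra R S \<longleftrightarrow>
     S \<subseteq> carrier R \<and> \<zero>\<^bsub>R\<^esub> \<in> S \<and>
     (\<forall>x\<in>S. \<forall>y\<in>S. x \<oplus>\<^bsub>R\<^esub> y \<in> S) \<and>
     (\<forall>c. \<forall>x\<in>S. c \<odot>\<^bsub>R\<^esub> x \<in> S) \<and>
     (\<forall>x\<in>S. \<forall>y\<in>S. lie_bracket R x y \<in> S)"

definition lie_generated :: "('f, 'a) module \<Rightarrow> 'a set \<Rightarrow> 'a set" where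
  "lie_generated R X = \<Inter>{S. lie_subalgebra R S \<and> X \<subseteq> S}"

definition lie_iso ::
  "('f, 'a) module \<Rightarrow> 'a set \<Rightarrow> ('f, 'b) module \<Rightarrow> 'b set \<Rightarrow> ('a \<Rightarrow> 'b) \<Rightarrow> bool" where
  "lie_iso R S R' S' \<phi> \<longleftrightarrow>
     bij_betw \<phi> S S' \<and>
     (\<forall>x\<in>S. \<forall>y\<in>S. \<phi> (x \<oplus>\<^bsub>R\<^esub> y) = \<phi> x \<oplus>\<^bsub>R'\<^esub> \<phi> y) \<and>
     (\<forall>c. \<forall>x\<in>S. \<phi> (c \<odot>\<^bsub>R\<^esub> x) = c \<odot>\<^bsub>R'\<^esub> \<phi> x) \<and>
     (\<forall>x\<in>S. \<forall>y\<in>S. \<phi> (lie_bracket R x y) = lie_bracket R' (\<phi> x) (\<phi> y))"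

definition free_lie :: "'f::field free_alg set" where
  "free_lie = lie_generated free_algebra (range gen)"

text \<open>A Lie subalgebra \<open>S\<close> of \<open>R\<close> is freely generated by \<open>g LA\<close>, \<open>g LB\<close>, \<open>g LC\<close> iff it is
  isomorphic to the free Lie algebra on the letters, with the letters corresponding to the
  elements \<open>g l\<close>.\<close>

definition freely_generated_by ::
  "('f::field, 'a) module \<Rightarrow> 'a set \<Rightarrow> (letter \<Rightarrow> 'a) \<Rightarrow> bool" where
  "freely_generated_by R S g \<longleftrightarrow>
     (\<exists>\<phi>. lie_iso free_algebra free_lie R S \<phi> \<and> (\<forall>l. \<phi> (gen l) = g l))"


section \<open>The universal Askey-Wilson algebra\<close>

definition aw_alpha :: "'f::field \<Rightarrow> 'f free_alg" where
  "aw_alpha q = scal (q + inverse q) (gen LA) +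
     scal (1 / (q - inverse q)) (scal q (gen LB * gen LC) - scal (inverse q) (gen LC * gen LB))"

definition aw_beta :: "'f::field \<Rightarrow> 'f free_alg" where
  "aw_beta q = scal (q + inverse q) (gen LB) +
     scal (1 / (q - inverse q)) (scal q (gen LC * gen LA) - scal (inverse q) (gen LA * gen LC))"

definition aw_gamma :: "'f::field \<Rightarrow> 'f free_alg" where
  "aw_gamma q = scal (q + inverse q) (gen LC) +
     scal (1 / (q - inverse q)) (scal q (gen LA * gen LB) - scal (inverse q) (gen LB * gen LA))"

definition aw_ideal :: "'f::field \<Rightarrow> 'f free_alg set" where
  "aw_ideal q = Idl\<^bsub>free_algebra\<^esub>
     {lie_bracket free_algebra (gen l) \<delta> | l \<delta>. \<delta> \<in> {aw_alpha q, aw_beta q, aw_gamma q}}"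

text \<open>The library quotient ring, equipped with the induced scalar multiplication of cosets.\<close>

definition quot_algebra :: "('f, 'a) module \<Rightarrow> 'a set \<Rightarrow> ('f, 'a set) module" where
  "quot_algebra R I =
     \<lparr>carrier = carrier (R Quot I), mult = mult (R Quot I), one = one (R Quot I),
      zero = zero (R Quot I), add = add (R Quot I),
      smult = (\<lambda>c X. \<Union>x\<in>X. I +>\<^bsub>R\<^esub> (c \<odot>\<^bsub>R\<^esub> x))\<rparr>"

definition aw_algebra :: "'f::field \<Rightarrow> ('f, 'f free_alg set) module" where
  "aw_algebra q = quot_algebra free_algebra (aw_ideal q)"

definition aw_proj :: "'f::field \<Rightarrow> 'f free_alg \<Rightarrow> 'f free_alg set" where
  "aw_proj q x = aw_ideal q +>\<^bsub>free_algebra\<^esub> x"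

definition aw_lie :: "'f::field \<Rightarrow> 'f free_alg set set" where
  "aw_lie q = lie_generated (aw_algebra q) (range (\<lambda>l. aw_proj q (gen l)))"


section \<open>Identification of the Lie subalgebra with a quotient of the free Lie algebra\<close>

lemma free_algebra_simps [simp]:
  "carrier free_algebra = UNIV" "mult free_algebra = (*)" "one free_algebra = 1"
  "zero free_algebra = 0" "add free_algebra = (+)" "smult free_algebra = scal"
  by (simp_all add: free_algebra_def)

lemma scal_conv_mult: "scal c x = Poly_Mapping.single 0 c * x"
  by (simp add: scal_def mult_map_scale_conv_mult)

lemma ring_free_algebra: "ring (free_algebra :: ('f::field, 'f free_alg) module)"
proof (rule ringI)
  show "abelian_group (free_algebra :: ('f, 'f free_alg) module)"
  proof (rule abelian_groupI)
    fix x :: "'f free_alg"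
    show "\<exists>y\<in>carrier free_algebra. y \<oplus>\<^bsub>free_algebra\<^esub> x = \<zero>\<^bsub>free_algebra\<^esub>"
      by (rule bexI[of _ "- x"]) simp_all
  qed (simp_all add: add.assoc add.commute)
  show "Group.monoid (free_algebra :: ('f, 'f free_alg) module)"
    by (rule monoidI) (simp_all add: mult.assoc)
qed (simp_all add: distrib_left distrib_right)

lemma a_minus_free_algebra [simp]: "x \<ominus>\<^bsub>free_algebra\<^esub> y = x - (y :: 'f::field free_alg)"
proof -
  interpret ring "free_algebra :: ('f, 'f free_alg) module" by (rule ring_free_algebra)
  have "\<ominus>\<^bsub>free_algebra\<^esub> y = - y"
    by (rule minus_equality) simp_all
  then show ?thesis by (simp add: a_minus_def)
qed

lemma lie_bracket_free_algebra [simp]: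
  "lie_bracket free_algebra x y = x * y - y * (x :: 'f::field free_alg)"
  by (simp add: lie_bracket_def)

lemma ideal_aw_ideal: "ideal (aw_ideal q) free_algebra"
  unfolding aw_ideal_def by (rule ring.genideal_ideal[OF ring_free_algebra]) simp

lemma scal_in_aw_ideal:
  assumes "x \<in> aw_ideal q" shows "scal c x \<in> aw_ideal q"
proof -
  interpret ideal "aw_ideal q" free_algebra by (rule ideal_aw_ideal)
  show ?thesis using I_l_closed[OF assms, of "Poly_Mapping.single 0 c"]
    by (simp add: scal_conv_mult)
qed

lemma aw_proj_eq_iff: "aw_proj q x = aw_proj q y \<longleftrightarrow> x - y \<in> aw_ideal q"
proof -
  interpret ideal "aw_ideal q" free_algebra by (rule ideal_aw_ideal)
  show ?thesis
    using quotient_eq_iff_same_a_r_cos[OF ideal_aw_ideal, of x y] by (simp add: aw_proj_def)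
qed

lemma ring_aw_algebra: "ring (aw_algebra q)"
proof -
  interpret ideal "aw_ideal q" free_algebra by (rule ideal_aw_ideal)
  interpret Q: ring "free_algebra Quot aw_ideal q" by (rule quotient_is_ring)
  have sel: "carrier (aw_algebra q) = carrier (free_algebra Quot aw_ideal q)"
    "mult (aw_algebra q) = mult (free_algebra Quot aw_ideal q)"
    "one (aw_algebra q) = one (free_algebra Quot aw_ideal q)"
    "zero (aw_algebra q) = zero (free_algebra Quot aw_ideal q)"
    "add (aw_algebra q) = add (free_algebra Quot aw_ideal q)"
    by (simp_all add: aw_algebra_def quot_algebra_def)
  show ?thesis
  proof (rule ringI)
    show "abelian_group (aw_algebra q)"
    proof (rule abelian_groupI; unfold sel)
      fix x assume "x \<in> carrier (free_algebra Quot aw_ideal q)"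
      then show "\<exists>y\<in>carrier (free_algebra Quot aw_ideal q).
          y \<oplus>\<^bsub>free_algebra Quot aw_ideal q\<^esub> x = \<zero>\<^bsub>free_algebra Quot aw_ideal q\<^esub>"
        using Q.a_inv_closed Q.l_neg by blast
    qed (simp_all add: Q.a_ac)
    show "Group.monoid (aw_algebra q)"
      by (rule monoidI; unfold sel) (simp_all add: Q.m_assoc)
  qed (simp_all add: sel Q.l_distr Q.r_distr)
qed

lemma aw_proj_simps:
  "carrier (aw_algebra q) = range (aw_proj q)"
  "zero (aw_algebra q) = aw_proj q 0"
  "aw_proj q x \<oplus>\<^bsub>aw_algebra q\<^esub> aw_proj q y = aw_proj q (x + y)"
  "aw_proj q x \<otimes>\<^bsub>aw_algebra q\<^esub> aw_proj q y = aw_proj q (x * y)"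
  "c \<odot>\<^bsub>aw_algebra q\<^esub> aw_proj q x = aw_proj q (scal c x)"
proof -
  interpret ideal "aw_ideal q" free_algebra by (rule ideal_aw_ideal)
  show "carrier (aw_algebra q) = range (aw_proj q)"
    by (auto simp: aw_algebra_def quot_algebra_def FactRing_def A_RCOSETS_def' aw_proj_def)
  show "zero (aw_algebra q) = aw_proj q 0"
    using a_coset_add_zero[of "aw_ideal q"]
    by (simp add: aw_algebra_def quot_algebra_def FactRing_def aw_proj_def)
  show "aw_proj q x \<oplus>\<^bsub>aw_algebra q\<^esub> aw_proj q y = aw_proj q (x + y)"
    using a_rcos_sum[of x y]
    by (simp add: aw_algebra_def quot_algebra_def FactRing_def aw_proj_def)
  show "aw_proj q x \<otimes>\<^bsub>aw_algebra q\<^esub> aw_proj q y = aw_proj q (x * y)"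
    using rcoset_mult_add[of x y]
    by (simp add: aw_algebra_def quot_algebra_def FactRing_def aw_proj_def)
  have mem: "y \<in> aw_proj q x \<longleftrightarrow> y - x \<in> aw_ideal q" for x y
    by (force simp: aw_proj_def a_r_coset_def r_coset_def)
  have "aw_proj q (scal c y) = aw_proj q (scal c x)" if "y \<in> aw_proj q x" for y
    using that scal_in_aw_ideal[of "y - x" q c]
    by (simp add: aw_proj_eq_iff mem scal_conv_mult right_diff_distrib)
  moreover have "x \<in> aw_proj q x"
    using additive_subgroup.zero_closed[OF is_additive_subgroup]
    by (simp add: mem)
  ultimately have "(\<Union>y\<in>aw_proj q x. aw_proj q (scal c y)) = aw_proj q (scal c x)"
    by blast
  then show "c \<odot>\<^bsub>aw_algebra q\<^esub> aw_proj q x = aw_proj q (scal c x)"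
    by (simp add: aw_algebra_def quot_algebra_def aw_proj_def)
qed

lemma aw_proj_bracket:
  "lie_bracket (aw_algebra q) (aw_proj q x) (aw_proj q y) = aw_proj q (x * y - y * x)"
proof -
  interpret ring "aw_algebra q" by (rule ring_aw_algebra)
  have c: "aw_proj q z \<in> carrier (aw_algebra q)" for z by (simp add: aw_proj_simps)
  have "\<ominus>\<^bsub>aw_algebra q\<^esub> aw_proj q (y * x) = aw_proj q (- (y * x))"
    by (rule minus_equality) (use c in \<open>simp_all add: aw_proj_simps\<close>)
  then show ?thesis
    by (simp add: lie_bracket_def a_minus_def aw_proj_simps)
qed

lemma lie_subalgebra_free_lie: "lie_subalgebra free_algebra free_lie"
  by (auto simp: free_lie_def lie_generated_def lie_subalgebra_def)

lemma gen_in_free_lie: "gen l \<in> free_lie"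
  by (auto simp: free_lie_def lie_generated_def)

text \<open>The Lie subalgebra generated by the images of the letters is the image of the free Lie
  algebra under the canonical projection, and by \<open>aw_proj_eq_iff\<close> the kernel of the restricted
  projection is \<open>aw_ideal q \<inter> free_lie\<close>.\<close>

lemma aw_lie_eq_image: "aw_lie q = aw_proj q ` free_lie"
proof
  have "lie_subalgebra (aw_algebra q) (aw_proj q ` free_lie)"
    using lie_subalgebra_free_lie
    unfolding lie_subalgebra_def
    by (auto simp: aw_proj_simps aw_proj_bracket)
  then show "aw_lie q \<subseteq> aw_proj q ` free_lie"
    using gen_in_free_lie unfolding aw_lie_def lie_generated_def by blast
next
  have "free_lie \<subseteq> aw_proj q -` S"
    if S: "lie_subalgebra (aw_algebra q) S" "range (\<lambda>l. aw_proj q (gen l)) \<subseteq> S" for S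
  proof -
    have z: "aw_proj q 0 \<in> S"
      using S(1) by (simp add: lie_subalgebra_def aw_proj_simps)
    have a: "aw_proj q (x + y) \<in> S" if "aw_proj q x \<in> S" "aw_proj q y \<in> S" for x y
      using S(1) that unfolding lie_subalgebra_def by (metis aw_proj_simps(3))
    have s: "aw_proj q (scal c x) \<in> S" if "aw_proj q x \<in> S" for c x
      using S(1) that unfolding lie_subalgebra_def by (metis aw_proj_simps(5))
    have b: "aw_proj q (x * y - y * x) \<in> S" if "aw_proj q x \<in> S" "aw_proj q y \<in> S" for x y
      using S(1) that unfolding lie_subalgebra_def by (metis aw_proj_bracket)
    have "lie_subalgebra free_algebra (aw_proj q -` S)"
      unfolding lie_subalgebra_def using z a s b by simp
    moreover have "range gen \<subseteq> aw_proj q -` S" using S(2) by auto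
    ultimately show ?thesis unfolding free_lie_def lie_generated_def by blast
  qed
  then show "aw_proj q ` free_lie \<subseteq> aw_lie q"
    unfolding aw_lie_def lie_generated_def by blast
qed

end

(* The Askey-Wilson relations reorder any word of length at most n, modulo the ideal, into a
   combination of the at most (n+1)^6 products alpha^r beta^s gamma^t A^i B^j C^k with total
   exponent at most n: the image in Delta of the degree filtration grows polynomially.  The free
   Lie algebra grows exponentially, since the 2^k nested brackets [x1,[x2,...[xk,C]...]] with
   letters xi in {A,B} are linearly independent: the only word x1...xk C in such a bracket that
   ends in C determines it.  For k = 62 there are more brackets than normal monomials, so a
   nontrivial combination of brackets lies in the ideal. *)

theory Submission
  imports Defs
begin

section \<open>Words as a basis of the free algebra\<close>

definition word :: "letter list \<Rightarrow> 'f::field free_alg" where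
  "word w = Poly_Mapping.single w 1"

lemma gen_eq_word: "gen l = word [l]"
  by (simp add: gen_def word_def)

lemma word_mult [simp]: "word u * word v = (word (u @ v) :: 'f::field free_alg)"
  by (simp add: word_def mult_single plus_list_def)

lemma word_Nil [simp]: "word [] = (1 :: 'f::field free_alg)"
  by (simp add: word_def flip: zero_list_def)

lemma lookup_word: "poly_mapping.lookup (word u :: 'f::field free_alg) v = (if u = v then 1 else 0)"
  by (simp add: word_def lookup_single when_def)

lemma lookup_scal [simp]:
  "poly_mapping.lookup (scal c x) w = c * poly_mapping.lookup (x :: 'f::field free_alg) w"
  by (simp add: scal_def Poly_Mapping.map.rep_eq when_def)

interpretation fa: vector_space "scal :: 'f::field \<Rightarrow> 'f free_alg \<Rightarrow> 'f free_alg"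
  by unfold_locales (rule poly_mapping_eqI; simp add: lookup_add algebra_simps)+

lemma scal_mult_left: "scal c x * y = scal c (x * (y :: 'f::field free_alg))"
  by (simp add: scal_conv_mult mult.assoc)

text \<open>Using only the words in the support of \<open>x\<close> lets a bound on their lengths
  bound the filtration degree of \<open>x\<close>.\<close>

lemma in_span_words: "(x :: 'f::field free_alg) \<in> fa.span (word ` Poly_Mapping.keys x)"
proof -
  have "x = (\<Sum>w\<in>Poly_Mapping.keys x. scal (poly_mapping.lookup x w) (word w))"
    by (rule poly_mapping_eqI)
      (simp add: lookup_sum lookup_word in_keys_iff if_distrib sum.delta cong: if_cong)
  then show ?thesis
    by (metis (no_types, lifting) fa.span_sum fa.span_scale fa.span_base imageI)
qed

text \<open>Words span the free algebra, so a property closed under sums and scaling only has to be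
  checked on them.\<close>

lemma word_induct [case_names add scal word]:
  fixes x :: "'f::field free_alg"
  assumes "\<And>x y. P x \<Longrightarrow> P y \<Longrightarrow> P (x + y)" and "\<And>c x. P x \<Longrightarrow> P (scal c x)" and "\<And>w. P (word w)"
  shows "P x"
proof -
  \<comment> \<open>The zero case comes from scaling a word by 0.\<close>
  have "P 0" using assms(2)[OF assms(3), of 0] by simp
  then have "fa.subspace {x. P x}" unfolding fa.subspace_def using assms by auto
  then have "fa.span (word ` Poly_Mapping.keys x) \<subseteq> {x. P x}" by (rule fa.span_minimal[rotated]) (use assms in auto)
  then show ?thesis using in_span_words by blast
qed

text \<open>\<open>scal\<close> is left multiplication by a constant, so the content is that
  constants are central. It suffices to treat \<open>y = 1\<close>, by induction on
  \<open>x\<close>.\<close>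

lemma mult_scal: "x * scal c y = scal c (x * (y :: 'f::field free_alg))"
proof -
  have "x * word [] * scal c 1 = scal c (x * word [])"
  proof (induction x rule: word_induct)
    case (word w)
    then show ?case by (simp add: scal_def word_def mult_single flip: single_one)
  qed (simp_all add: scal_mult_left distrib_right fa.scale_right_distrib)
  then have "x * scal c 1 * y = scal c x * y" by simp
  then show ?thesis by (simp add: mult.assoc scal_mult_left)
qed

lemma lookup_gen_mult:
  "poly_mapping.lookup (gen x * p :: 'f::field free_alg) (y # v)
    = (if x = y then poly_mapping.lookup p v else 0)"
  by (induction p rule: word_induct)
    (auto simp: distrib_left lookup_add mult_scal gen_eq_word lookup_word)

lemma lookup_mult_gen:
  "poly_mapping.lookup (p * gen x :: 'f::field free_alg) (v @ [y])
    = (if x = y then poly_mapping.lookup p v else 0)"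
  by (induction p rule: word_induct)
    (auto simp: distrib_right lookup_add scal_mult_left gen_eq_word lookup_word)


section \<open>Nested brackets\<close>

text \<open>The iterated adjoint action of the letters of the word, applied to C.\<close>

fun nested :: "letter list \<Rightarrow> 'f::field free_alg" where
  "nested [] = gen LC"
| "nested (x # w) = gen x * nested w - nested w * gen x"

lemma nested_in_free_lie: "nested w \<in> free_lie"
proof (induction w)
  case (Cons x w)
  then show ?case
    using lie_subalgebra_free_lie gen_in_free_lie[of x] unfolding lie_subalgebra_def
    by (metis lie_bracket_free_algebra nested.simps(2))
qed (simp add: gen_in_free_lie)

text \<open>Of the two products in a bracket, \<open>nested w * gen x\<close> has only words ending
  in \<open>x\<close>, which is not C. So words ending in C come from
  \<open>gen x * nested w\<close> alone, and stripping the first letter gives the recursion.\<close>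

lemma lookup_nested:
  assumes "LC \<notin> set w"
  shows "poly_mapping.lookup (nested w :: 'f::field free_alg) (v @ [LC]) = (if w = v then 1 else 0)"
  using assms
proof (induction w arbitrary: v)
  case Nil
  then show ?case by (simp add: gen_eq_word lookup_word)
next
  case (Cons x w)
  have "poly_mapping.lookup (nested w * gen x :: 'f free_alg) (v @ [LC]) = 0"
    using Cons.prems by (auto simp: lookup_mult_gen)
  moreover have "poly_mapping.lookup (gen x * nested w :: 'f free_alg) (v @ [LC])
      = (if x # w = v then 1 else 0)"
    using Cons by (cases v) (auto simp: lookup_gen_mult)
  ultimately show ?case by (simp add: lookup_minus)
qed

text \<open>Homogeneity of the brackets; it places them in a fixed step of the degree
  filtration.\<close>

lemma keys_nested:
  "Poly_Mapping.keys (nested w :: 'f::field free_alg) \<subseteq> {u. length u = Suc (length w)}"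
proof (induction w)
  case (Cons x w)
  have "Poly_Mapping.keys (gen x * nested w :: 'f free_alg) \<subseteq> {u. length u = Suc (length (x # w))}"
    "Poly_Mapping.keys (nested w * gen x :: 'f free_alg) \<subseteq> {u. length u = Suc (length (x # w))}"
    using Cons keys_mult[of "gen x :: 'f free_alg" "nested w"]
      keys_mult[of "nested w" "gen x :: 'f free_alg"]
    by (fastforce simp: gen_def plus_list_def)+
  then show ?case
    unfolding subset_iff in_keys_iff by (simp add: lookup_minus) (metis diff_zero)
qed (simp add: gen_def)


section \<open>Reordering words modulo the ideal\<close>

lemma aw_ideal_closed:
  fixes x y :: "'f::field free_alg"
  shows aw_ideal_zero: "0 \<in> aw_ideal q"
    and aw_ideal_add: "x \<in> aw_ideal q \<Longrightarrow> y \<in> aw_ideal q \<Longrightarrow> x + y \<in> aw_ideal q"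
    and aw_ideal_mult_left: "x \<in> aw_ideal q \<Longrightarrow> y * x \<in> aw_ideal q"
    and aw_ideal_mult_right: "x \<in> aw_ideal q \<Longrightarrow> x * y \<in> aw_ideal q"
proof -
  interpret ideal "aw_ideal q" free_algebra by (rule ideal_aw_ideal)
  show "0 \<in> aw_ideal q" "x \<in> aw_ideal q \<Longrightarrow> y \<in> aw_ideal q \<Longrightarrow> x + y \<in> aw_ideal q"
    "x \<in> aw_ideal q \<Longrightarrow> y * x \<in> aw_ideal q" "x \<in> aw_ideal q \<Longrightarrow> x * y \<in> aw_ideal q"
    using additive_subgroup.zero_closed[OF is_additive_subgroup]
      additive_subgroup.a_closed[OF is_additive_subgroup, of x y] I_l_closed[of x y] I_r_closed[of x y] by simp_all
qed

lemma subspace_aw_ideal: "fa.subspace (aw_ideal q)"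
  unfolding fa.subspace_def by (blast intro: aw_ideal_zero aw_ideal_add scal_in_aw_ideal)

abbreviation aw_centrals :: "'f::field \<Rightarrow> 'f free_alg set" where
  "aw_centrals q \<equiv> {aw_alpha q, aw_beta q, aw_gamma q}"

lemma central_commute_gen:
  assumes "\<delta> \<in> aw_centrals q"
  shows "gen l * \<delta> - \<delta> * gen l \<in> aw_ideal q"
proof -
  have "lie_bracket free_algebra (gen l) \<delta> \<in> aw_ideal q"
    unfolding aw_ideal_def
    by (rule subsetD[OF ring.genideal_self[OF ring_free_algebra]]) (use assms in auto)
  then show ?thesis by simp
qed

text \<open>The commutator with \<delta> is a derivation: the Leibniz rule carries centrality modulo
  the ideal from letters to words, and linearity from words to all elements.\<close>

lemma central_commute:
  assumes "\<delta> \<in> aw_centrals q"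
  shows "x * \<delta> - \<delta> * x \<in> aw_ideal q"
proof (induction x rule: word_induct)
  case (add x y)
  then show ?case using aw_ideal_add by (fastforce simp: algebra_simps)
next
  case (scal c x)
  then show ?case
    using scal_in_aw_ideal[of _ q c] by (fastforce simp: scal_mult_left mult_scal fa.scale_right_diff_distrib)
next
  case (word w)
  show ?case
  proof (induction w)
    case (Cons l w)
    have "word (l # w) = gen l * (word w :: 'a free_alg)"
      by (simp add: gen_eq_word)
    then have "word (l # w) * \<delta> - \<delta> * word (l # w)
        = gen l * (word w * \<delta> - \<delta> * word w) + (gen l * \<delta> - \<delta> * gen l) * word w"
      by (simp add: algebra_simps)
    then show ?case
      using Cons central_commute_gen[OF assms] by (simp add: aw_ideal_closed)
  qed (simp add: aw_ideal_zero)
qed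

section \<open>Normal monomials and their span modulo the ideal\<close>

text \<open>Monomials of PBW type. Each of \<alpha>, \<beta>, \<gamma> has weight one although it
  contains words of length two: in reordering, it stands in for a product of two letters, so the
  weight never exceeds the length.\<close>

definition normal_monomials :: "'f::field \<Rightarrow> nat \<Rightarrow> 'f free_alg set" where
  "normal_monomials q n =
    {aw_alpha q ^ r * aw_beta q ^ s * aw_gamma q ^ t *
      word (replicate i LA @ replicate j LB @ replicate k LC) | r s t i j k.
      r + s + t + i + j + k \<le> n}"

text \<open>Each of the six exponents is at most \<open>n\<close>, so a box with
  \<open>Suc n ^ 6\<close> points maps onto a superset.\<close>

lemma normal_monomials_bound:
  "finite (normal_monomials q n) \<and> card (normal_monomials q n) \<le> Suc n ^ 6"
proof -
  let ?f = "\<lambda>(r, s, t, i, j, k). aw_alpha q ^ r * aw_beta q ^ s * aw_gamma q ^ t *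
      word (replicate i LA @ replicate j LB @ replicate k LC)"
  let ?D = "{..n} \<times> {..n} \<times> {..n} \<times> {..n} \<times> {..n} \<times> {..n}"
  have sub: "normal_monomials q n \<subseteq> ?f ` ?D"
    unfolding normal_monomials_def by (force simp: image_iff)
  have "card (normal_monomials q n) \<le> card (?f ` ?D)"
    by (rule card_mono[OF _ sub]) simp
  also have "\<dots> \<le> card ?D" by (rule card_image_le) simp
  also have "\<dots> = Suc n ^ 6" by (simp add: card_cartesian_product eval_nat_numeral)
  finally show ?thesis using finite_subset[OF sub] by simp
qed

text \<open>Adjoining the ideal to the spanning set replaces computation with cosets: this is the
  preimage of the span of the normal monomials in the quotient.\<close>

definition normal_span :: "'f::field \<Rightarrow> nat \<Rightarrow> 'f free_alg set" where
  "normal_span q n = fa.span (normal_monomials q n \<union> aw_ideal q)"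

lemma normal_span_mono: "m \<le> n \<Longrightarrow> normal_span q m \<subseteq> normal_span q n"
  unfolding normal_span_def normal_monomials_def
  by (intro fa.span_mono Un_mono order_refl) (blast intro: order_trans)

lemma aw_ideal_subset_normal_span: "aw_ideal q \<subseteq> normal_span q n"
  unfolding normal_span_def using fa.span_superset by blast

text \<open>Modulo the ideal, \<delta> slides past the preceding central powers to its own power,
  raising one exponent by one.\<close>

lemma central_mult_monomial:
  assumes "\<delta> \<in> aw_centrals q" and "x \<in> normal_monomials q n"
  shows "\<delta> * x \<in> normal_span q (Suc n)"
proof -
  from assms(2) obtain r s t i j k where
    x: "x = aw_alpha q ^ r * aw_beta q ^ s * aw_gamma q ^ t *
      word (replicate i LA @ replicate j LB @ replicate k LC)" (is "_ = ?a * ?b * ?c * ?w")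
    and le: "r + s + t + i + j + k \<le> n"
    unfolding normal_monomials_def by blast
  have mono: "aw_alpha q ^ r' * aw_beta q ^ s' * aw_gamma q ^ t' * ?w \<in> normal_span q (Suc n)"
    if "r' + s' + t' \<le> Suc (r + s + t)" for r' s' t'
    unfolding normal_span_def using le that
    by (intro fa.span_base UnI1) (force simp: normal_monomials_def)
  have move: "\<delta> * (y * z) \<in> normal_span q (Suc n)"
    if "y * \<delta> * z \<in> normal_span q (Suc n)" for y z
  proof -
    have "(y * \<delta> - \<delta> * y) * z \<in> normal_span q (Suc n)"
      using aw_ideal_mult_right[OF central_commute[OF assms(1)]] aw_ideal_subset_normal_span by blast
    then have "y * \<delta> * z - (y * \<delta> - \<delta> * y) * z \<in> normal_span q (Suc n)"
      using that fa.span_diff unfolding normal_span_def by blast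
    then show ?thesis by (simp add: algebra_simps)
  qed
  consider "\<delta> = aw_alpha q" | "\<delta> = aw_beta q" | "\<delta> = aw_gamma q" using assms(1) by blast
  then show ?thesis
  proof cases
    case 1
    then show ?thesis using mono[of "Suc r" s t] by (simp add: x mult.assoc)
  next
    case 2
    then show ?thesis using move[of ?a "?b * ?c * ?w"] mono[of r "Suc s" t]
      by (simp add: x mult.assoc)
  next
    case 3
    then show ?thesis using move[of "?a * ?b" "?c * ?w"] mono[of r s "Suc t"]
      by (simp add: x mult.assoc)
  qed
qed

lemma central_mult_normal_span:
  assumes "\<delta> \<in> aw_centrals q" and "x \<in> normal_span q n"
  shows "\<delta> * x \<in> normal_span q (Suc n)"
proof -
  have "fa.subspace {x. \<delta> * x \<in> normal_span q (Suc n)}"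
    unfolding normal_span_def fa.subspace_def
    by (auto simp: distrib_left mult_scal intro: fa.span_add fa.span_scale fa.span_zero)
  moreover have "normal_monomials q n \<union> aw_ideal q \<subseteq> {x. \<delta> * x \<in> normal_span q (Suc n)}"
    using central_mult_monomial[OF assms(1)] aw_ideal_mult_left aw_ideal_subset_normal_span by blast
  ultimately show ?thesis
    using fa.span_minimal assms(2) unfolding normal_span_def by blast
qed

section \<open>Sorting words by adjacent swaps\<close>

definition letter_less :: "(letter \<times> letter) set" where
  "letter_less = {(LA, LB), (LA, LC), (LB, LC)}"

lemma wf_letter_less: "wf letter_less"
  by (rule wf_subset[OF wf_measure[of "case_letter 0 1 (2::nat)"]]) (auto simp: letter_less_def)

text \<open>Prepending a letter to a sorted word either keeps it sorted or creates an inversion at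
  the front.\<close>

lemma sorted_word_cases:
  obtains (sorted) i j k where "w = replicate i LA @ replicate j LB @ replicate k LC"
  | (inversion) u x y v where "w = u @ [y, x] @ v" and "(x, y) \<in> letter_less"
proof -
  have "(\<exists>i j k. w = replicate i LA @ replicate j LB @ replicate k LC) \<or>
    (\<exists>u x y v. w = u @ [y, x] @ v \<and> (x, y) \<in> letter_less)"
  proof (induction w)
    case (Cons l w)
    then show ?case
    proof (elim disjE exE conjE)
      fix u x y v assume "w = u @ [y, x] @ v" "(x, y) \<in> letter_less"
      then show ?thesis by (metis append_Cons)
    next
      fix i j k assume w: "w = replicate i LA @ replicate j LB @ replicate k LC"
      show ?thesis
      proof (cases "w = [] \<or> (hd w, l) \<notin> letter_less")
        case True
        have "\<exists>i j k. l # w = replicate i LA @ replicate j LB @ replicate k LC"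
        proof (cases l)
          case LA
          then show ?thesis using w by (metis append_Cons replicate_Suc)
        next
          case LB
          then have "i = 0" using True w by (cases i) (auto simp: letter_less_def)
          then show ?thesis using LB w by (metis append_Cons append_Nil replicate_0 replicate_Suc)
        next
          case LC
          then have "i = 0" "j = 0" using True w by (cases i; cases j; auto simp: letter_less_def)+
          then show ?thesis using LC w by (metis append_Nil replicate_0 replicate_Suc)
        qed
        then show ?thesis by blast
      next
        case False
        then have "l # w = [] @ [l, hd w] @ tl w" by simp
        then show ?thesis using False by blast
      qed
    qed
  next
    case Nil
    then show ?case by (metis append_Nil replicate_0)
  qed
  then show ?thesis using sorted inversion by blast
qed

text \<open>Solves the definition of \<alpha>, \<beta> or \<gamma> for the product of two letters in
  the wrong order.\<close>

lemma solve_right_product: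
  fixes z P Q :: "'f::field free_alg"
  assumes "b * d \<noteq> 0" and "\<delta> = scal a z + scal b (scal c P - scal d Q)"
  shows "Q = scal (c / d) P + scal (- 1 / (b * d)) \<delta> + scal (a / (b * d)) z"
  by (rule poly_mapping_eqI) (use assms(1) in \<open>simp add: assms(2) lookup_add lookup_minus field_simps\<close>)

lemma swap_letters:
  fixes q :: "'f::field"
  assumes "q \<noteq> 0" and "q ^ 4 \<noteq> 1" and "(x, y) \<in> letter_less"
  shows "\<exists>\<delta>\<in>aw_centrals q. \<exists>c d e z.
    word [y, x] = scal c (word [x, y]) + scal d \<delta> + scal e (word [z])"
proof -
  have "q ^ 4 = (q\<^sup>2)\<^sup>2" by (simp flip: power_mult)
  then have "q\<^sup>2 \<noteq> 1" using assms(2) by (metis one_power2)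
  \<comment> \<open>Since division by zero yields zero, this says that \<open>q - inverse q\<close>
    is nonzero.\<close>
  then have ne: "1 / (q - inverse q) \<noteq> 0"
    using assms(1) by (simp add: field_simps power2_eq_square)
  have 1: "1 / (q - inverse q) * inverse q \<noteq> 0" "1 / (q - inverse q) * - q \<noteq> 0"
    using ne assms(1) by simp_all
  \<comment> \<open>In \<beta> the wrongly ordered product CA comes first, so both signs are flipped
    to bring it into the position of \<open>Q\<close>.\<close>
  have beta: "aw_beta q = scal (q + inverse q) (word [LB]) +
      scal (1 / (q - inverse q)) (scal (- inverse q) (word [LA, LC]) - scal (- q) (word [LC, LA]))"
    by (simp add: aw_beta_def gen_eq_word)
  have *: "aw_alpha q = scal (q + inverse q) (word [LA]) +
      scal (1 / (q - inverse q)) (scal q (word [LB, LC]) - scal (inverse q) (word [LC, LB]))"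
    "aw_gamma q = scal (q + inverse q) (word [LC]) +
      scal (1 / (q - inverse q)) (scal q (word [LA, LB]) - scal (inverse q) (word [LB, LA]))"
    by (simp_all add: aw_alpha_def aw_gamma_def gen_eq_word)
  show ?thesis
    using assms(3) solve_right_product[OF 1(1) *(1)] solve_right_product[OF 1(1) *(2)]
      solve_right_product[OF 1(2) beta]
    unfolding letter_less_def by blast
qed

text \<open>Induction on \<open>lenlex\<close>. Swapping an inverted pair gives a lexicographically
  smaller word of the same length, a word shorter by one, and a central element inside a word
  shorter by two.\<close>

lemma word_in_normal_span:
  fixes q :: "'f::field"
  assumes "q \<noteq> 0" and "q ^ 4 \<noteq> 1"
  shows "word w \<in> normal_span q (length w)"
proof (induction w rule: wf_induct_rule[OF wf_lenlex[OF wf_letter_less]])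
  case (1 w)
  show ?case
  proof (cases w rule: sorted_word_cases)
    case (sorted i j k)
    then have "word w = aw_alpha q ^ 0 * aw_beta q ^ 0 * aw_gamma q ^ 0 *
        word (replicate i LA @ replicate j LB @ replicate k LC)" by simp
    moreover have "0 + 0 + 0 + i + j + k \<le> length w" using sorted by simp
    ultimately have "word w \<in> normal_monomials q (length w)"
      unfolding normal_monomials_def by blast
    then show ?thesis unfolding normal_span_def by (blast intro: fa.span_base)
  next
    case (inversion u x y v)
    obtain \<delta> c d e z where \<delta>: "\<delta> \<in> aw_centrals q"
      and swap: "word [y, x] = scal c (word [x, y]) + scal d \<delta> + scal e (word [z])"
      using swap_letters[OF assms inversion(2)] by blast
    have IH: "word w' \<in> normal_span q (length w)"
      if "(w', w) \<in> lenlex letter_less" for w'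
      using 1[OF that] normal_span_mono[OF lenlex_length[OF that]] by blast
    have swapped: "word (u @ [x, y] @ v) \<in> normal_span q (length w)"
    proof (rule IH)
      \<comment> \<open>Irreflexivity allows the common prefix \<open>u\<close> to be
        cancelled.\<close>
      have "irrefl letter_less" by (simp add: irrefl_def letter_less_def)
      then show "(u @ [x, y] @ v, w) \<in> lenlex letter_less"
        using inversion by (simp add: Cons_lenlex_iff)
    qed
    have shorter: "word (u @ [z] @ v) \<in> normal_span q (length w)"
      by (rule IH) (use inversion in \<open>simp add: lenlex_conv\<close>)
    \<comment> \<open>The sharper bound \<open>length (u @ v)\<close>, two below
      \<open>length w\<close>, leaves room for the factor \<delta>.\<close>
    have "word (u @ v) \<in> normal_span q (length (u @ v))"
      by (rule 1) (use inversion in \<open>simp add: lenlex_conv\<close>)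
    from central_mult_normal_span[OF \<delta> this]
    have "\<delta> * word (u @ v) \<in> normal_span q (length w)"
      using normal_span_mono[of "Suc (length (u @ v))" "length w"] inversion(1) by auto
    \<comment> \<open>Correction for moving \<delta> from the front to its place between
      \<open>u\<close> and \<open>v\<close>.\<close>
    moreover have "(word u * \<delta> - \<delta> * word u) * word v \<in> normal_span q (length w)"
      using aw_ideal_mult_right[OF central_commute[OF \<delta>]] aw_ideal_subset_normal_span by blast
    ultimately have "\<delta> * word (u @ v) + (word u * \<delta> - \<delta> * word u) * word v \<in> normal_span q (length w)"
      unfolding normal_span_def by (rule fa.span_add)
    moreover have "\<delta> * word (u @ v) + (word u * \<delta> - \<delta> * word u) * word v = word u * \<delta> * word v"
      by (simp add: left_diff_distrib mult.assoc)
    ultimately have central: "word u * \<delta> * word v \<in> normal_span q (length w)" by simp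
    have "word w = word u * word [y, x] * word v" by (simp add: inversion(1))
    also have "\<dots> = scal c (word (u @ [x, y] @ v)) + scal d (word u * \<delta> * word v)
        + scal e (word (u @ [z] @ v))"
      unfolding swap by (simp add: distrib_left distrib_right mult_scal scal_mult_left)
    finally show ?thesis
      using swapped shorter central unfolding normal_span_def
      by (simp add: fa.span_add fa.span_scale)
  qed
qed

lemma nested_in_normal_span:
  fixes q :: "'f::field"
  assumes "q \<noteq> 0" and "q ^ 4 \<noteq> 1"
  shows "nested w \<in> normal_span q (Suc (length w))"
proof -
  have "word ` Poly_Mapping.keys (nested w :: 'f free_alg) \<subseteq> normal_span q (Suc (length w))"
  proof
    fix x :: "'f free_alg"
    assume "x \<in> word ` Poly_Mapping.keys (nested w :: 'f free_alg)"
    then obtain u where u: "x = word u" "u \<in> Poly_Mapping.keys (nested w :: 'f free_alg)" by blast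
    then have "length u = Suc (length w)" using keys_nested by blast
    then show "x \<in> normal_span q (Suc (length w))" using word_in_normal_span[OF assms, of u] u(1) by simp
  qed
  then have "fa.span (word ` Poly_Mapping.keys (nested w :: 'f free_alg)) \<subseteq> normal_span q (Suc (length w))"
    unfolding normal_span_def by (rule fa.span_minimal) (rule fa.subspace_span)
  then show ?thesis using in_span_words by blast
qed


section \<open>Comparing dimensions\<close>

text \<open>The relation is among an indexed family: two equal values already give one with
  coefficients 1 and -1, and an injective family has too many values to be independent.\<close>

lemma (in vector_space) nontrivial_relation:
  assumes "finite W" and "finite T" and "card T < card W" and "f ` W \<subseteq> span T"
  obtains c v where "v \<in> W" and "c v \<noteq> 0" and "(\<Sum>w\<in>W. scale (c w) (f w)) = 0"
proof (cases "inj_on f W")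
  case True
  then have "dependent (f ` W)"
    using independent_span_bound[of T "f ` W"] assms by (auto simp: card_image)
  then obtain u v where "v \<in> f ` W" "u v \<noteq> 0" "(\<Sum>y\<in>f ` W. scale (u y) y) = 0"
    using assms(1) by (auto simp: dependent_finite)
  then show ?thesis
    using that[of _ "u \<circ> f"] True by (auto simp: sum.reindex)
next
  case False
  then obtain v v' where v: "v \<in> W" "v' \<in> W" "v \<noteq> v'" "f v = f v'"
    unfolding inj_on_def by blast
  define c :: "_ \<Rightarrow> 'a" where "c w = (if w = v then 1 else if w = v' then - 1 else 0)" for w
  have "(\<Sum>w\<in>W. scale (c w) (f w)) = (\<Sum>w\<in>{v, v'}. scale (c w) (f w))"
    by (rule sum.mono_neutral_right) (use v assms(1) in \<open>auto simp: c_def\<close>)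
  also have "\<dots> = 0" using v by (simp add: c_def)
  finally show ?thesis using that[of v c] v(1) by (simp add: c_def)
qed

lemma subspace_free_lie: "fa.subspace (free_lie :: 'f::field free_alg set)"
  using lie_subalgebra_free_lie[where ?'a = 'f] unfolding fa.subspace_def lie_subalgebra_def by simp

lemma aw_ideal_meets_free_lie:
  fixes q :: "'f::field"
  assumes "q \<noteq> 0" and "q ^ 4 \<noteq> 1"
  obtains x where "x \<in> aw_ideal q" and "x \<in> free_lie" and "x \<noteq> 0"
proof -
  \<comment> \<open>With 62 letters the brackets have degree 63, so at most
    \<open>64 ^ 6 = 2 ^ 36\<close> normal monomials face \<open>2 ^ 62\<close> brackets.\<close>
  define W where "W = {w. set w \<subseteq> {LA, LB} \<and> length w = 62}"
  have W: "finite W" "card W = 2 ^ 62"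
    unfolding W_def using finite_lists_length_eq[of "{LA, LB}" 62] card_lists_length_eq[of "{LA, LB}" 62]
    by (simp_all flip: numeral_2_eq_2)
  have "\<exists>m y. m \<in> fa.span (normal_monomials q 63) \<and> y \<in> aw_ideal q \<and> nested w = m + y"
    if "w \<in> W" for w
  proof -
    have "nested w \<in> fa.span (normal_monomials q 63 \<union> aw_ideal q)"
      using nested_in_normal_span[OF assms, of w] that by (simp add: normal_span_def W_def)
    moreover have "fa.span (aw_ideal q) = aw_ideal q" by (simp add: subspace_aw_ideal)
    ultimately show ?thesis unfolding fa.span_Un by auto
  qed
  then obtain m y where my: "\<And>w. w \<in> W \<Longrightarrow> m w \<in> fa.span (normal_monomials q 63)"
    "\<And>w. w \<in> W \<Longrightarrow> y w \<in> aw_ideal q" "\<And>w. w \<in> W \<Longrightarrow> nested w = m w + y w"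
    by metis
  have "card (normal_monomials q 63) < card W"
    using normal_monomials_bound[of q 63] W(2) by simp
  then obtain c v where c: "v \<in> W" "c v \<noteq> 0" "(\<Sum>w\<in>W. scal (c w) (m w)) = 0"
    using fa.nontrivial_relation[of W "normal_monomials q 63" m] W(1) my(1)
      normal_monomials_bound[of q 63] by blast
  \<comment> \<open>The relation among the normal parts \<open>m w\<close> is applied to the
    brackets themselves, so that only the ideal parts \<open>y w\<close> survive.\<close>
  define x where "x = (\<Sum>w\<in>W. scal (c w) (nested w))"
  have "x = (\<Sum>w\<in>W. scal (c w) (m w)) + (\<Sum>w\<in>W. scal (c w) (y w))"
    unfolding x_def using my(3) by (simp add: fa.scale_right_distrib sum.distrib)
  then have "x = (\<Sum>w\<in>W. scal (c w) (y w))" using c(3) by simp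
  then have "x \<in> aw_ideal q"
    using my(2) by (simp add: fa.subspace_sum[OF subspace_aw_ideal] scal_in_aw_ideal)
  moreover have "x \<in> free_lie"
    unfolding x_def
    by (intro fa.subspace_sum fa.subspace_scale subspace_free_lie nested_in_free_lie)
  \<comment> \<open>Among the brackets indexed by \<open>W\<close>, the word \<open>v @ [LC]\<close>
    occurs only in \<open>nested v\<close>, so its coefficient in \<open>x\<close> isolates
    \<open>c v\<close>.\<close>
  moreover have "poly_mapping.lookup x (v @ [LC]) = (\<Sum>w\<in>W. if w = v then c w else 0)"
    unfolding x_def lookup_sum lookup_scal
    by (rule sum.cong[OF refl]) (subst lookup_nested, auto simp: W_def)
  then have "poly_mapping.lookup x (v @ [LC]) = c v"
    using c(1) W(1) by simp
  then have "x \<noteq> 0" using c(2) by auto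
  ultimately show ?thesis by (rule that)
qed

section \<open>From the nonzero kernel to non-freeness\<close>

text \<open>The elements where \<phi> and the projection agree form a Lie subalgebra containing the
  letters, hence all of \<open>free_lie\<close>.\<close>

lemma lie_iso_eq_aw_proj:
  fixes q :: "'f::field"
  assumes iso: "lie_iso free_algebra free_lie (aw_algebra q) (aw_lie q) \<phi>"
    and gen: "\<And>l. \<phi> (gen l) = aw_proj q (gen l)" and "x \<in> free_lie"
  shows "\<phi> x = aw_proj q x"
proof -
  have sub: "lie_subalgebra free_algebra (free_lie :: 'f free_alg set)" by (rule lie_subalgebra_free_lie)
  have z: "(0 :: 'f free_alg) \<in> free_lie" using sub by (simp add: lie_subalgebra_def)
  \<comment> \<open>\<open>lie_iso\<close> does not mention zero, so \<open>\<phi> 0\<close> is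
    found by scaling with 0; writing it as a coset first makes the scalar action of the quotient
    computable.\<close>
  have "\<phi> 0 \<in> aw_proj q ` free_lie"
    using iso z unfolding lie_iso_def aw_lie_eq_image by (blast dest: bij_betwE)
  then obtain y where y: "\<phi> 0 = aw_proj q y" by blast
  have "\<phi> (scal 0 0) = 0 \<odot>\<^bsub>aw_algebra q\<^esub> \<phi> 0"
    using iso z unfolding lie_iso_def by (metis free_algebra_simps(6))
  then have "\<phi> (scal 0 0) = aw_proj q (scal 0 y)"
    by (simp only: y aw_proj_simps)
  then have "\<phi> 0 = aw_proj q 0" by simp
  then have "lie_subalgebra free_algebra {x \<in> free_lie. \<phi> x = aw_proj q x}"
    using sub iso unfolding lie_subalgebra_def lie_iso_def
    by (auto simp: aw_proj_simps aw_proj_bracket)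
  then have "free_lie \<subseteq> {x \<in> free_lie. \<phi> x = aw_proj q x}"
    unfolding free_lie_def[unfolded lie_generated_def]
    using gen gen_in_free_lie[unfolded free_lie_def lie_generated_def] by blast
  then show ?thesis using assms(3) by blast
qed

theorem theorem4p6:
  fixes q :: "'f :: alg_closed_field"
  assumes "q \<noteq> 0" and "q ^ 4 \<noteq> 1"
  shows "\<not> freely_generated_by (aw_algebra q) (aw_lie q) (\<lambda>l. aw_proj q (gen l))
    \<and> aw_ideal q \<inter> free_lie \<noteq> {0}"
proof -
  obtain x where x: "x \<in> aw_ideal q" "x \<in> free_lie" "x \<noteq> 0"
    using aw_ideal_meets_free_lie[OF assms] .
  have "\<not> freely_generated_by (aw_algebra q) (aw_lie q) (\<lambda>l. aw_proj q (gen l))"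
  proof
    assume "freely_generated_by (aw_algebra q) (aw_lie q) (\<lambda>l. aw_proj q (gen l))"
    then obtain \<phi> where iso: "lie_iso free_algebra free_lie (aw_algebra q) (aw_lie q) \<phi>"
      and gen: "\<And>l. \<phi> (gen l) = aw_proj q (gen l)"
      unfolding freely_generated_by_def by blast
    have z: "(0 :: 'f free_alg) \<in> free_lie" using fa.subspace_0[OF subspace_free_lie] .
    \<comment> \<open>The projection identifies \<open>x\<close> with 0, so \<phi>, which agrees
      with it on \<open>free_lie\<close>, cannot be injective.\<close>
    have "aw_proj q x = aw_proj q 0" using x(1) by (simp add: aw_proj_eq_iff)
    then have "\<phi> x = \<phi> 0" using lie_iso_eq_aw_proj[OF iso gen] x(2) z by simp
    then show False
      using iso x(2,3) z unfolding lie_iso_def by (auto dest: bij_betw_imp_inj_on inj_onD)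
  qed
  then show ?thesis using x by blast
qed

end
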